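(* Let $H$ be a hypergraph. A subset $U\subseteq V(H)$ is linearly dependent if and only if $I_H^Tx=0$ for some non-zero vector $x:V(H)\to\mathbb{R}$ such that $\operatorname{supp}(x)\subseteq U$.
   Context: A hypergraph $H=(V(H),E(H))$ consists of a finite non-empty vertex set $V(H)$ and a set $E(H)\subseteq\mathcal{P}(V(H))$ of hyperedges. The incidence matrix $I_H=[i_{ve}]_{v\in V(H),e\in E(H)}$ has rows indexed by vertices and columns indexed by hyperedges, with $i_{ve}=1$ if $v\in e$ and $i_{ve}=0$ otherwise. For $x:V(H)\to\mathbb{R}$, $(I_H^Tx)(e)=\sum_{v\in V(H)}i_{ve}x(v)$. For $v\in V(H)$ let $s_v:E(H)\to\{0,1\}$, $s_v(e)=i_{ve}$ (the $v$-th row of $I_H$). A subset $U\subseteq V(H)$ is linearly dependent if the family of rows $(s_v)_{v\in U}$ (indexed by $U$, so that two distinct vertices with equal rows form a dependent set) is linearly dependent in $\mathbb{R}^{E(H)}$. The support of a function $x$ is $\operatorname{supp}(x)=\{v:x(v)\neq 0\}$. *)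

theory Defs
  imports Complex_Main "HOL-Library.Function_Algebras"
begin

instantiation "fun" :: (type, real_vector) real_vector
begin

definition scaleR_fun :: "real \<Rightarrow> ('a \<Rightarrow> 'b) \<Rightarrow> 'a \<Rightarrow> 'b"
  where "scaleR_fun c f = (\<lambda>a. c *\<^sub>R f a)"

instance
  by standard (simp_all add: scaleR_fun_def fun_eq_iff scaleR_add_right scaleR_add_left)

end

lemma scaleR_fun_apply [simp]: "(c *\<^sub>R f) a = c *\<^sub>R f a"
  by (simp add: scaleR_fun_def)

text \<open>The space of functions from \<^term>\<open>A\<close> to the reals is rendered as the subspace of those
  functions on the whole type that vanish off \<^term>\<open>A\<close>.\<close>

definition fun_space :: "'a set \<Rightarrow> ('a \<Rightarrow> real) set"
  where "fun_space A = {f. \<forall>a. a \<notin> A \<longrightarrow> f a = 0}"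

lemma subspace_fun_space: "subspace (fun_space A)"
  by (simp add: subspace_def fun_space_def)

definition supp :: "('a \<Rightarrow> real) \<Rightarrow> 'a set"
  where "supp x = {a. x a \<noteq> 0}"

text \<open>The library's \<^const>\<open>dependent\<close> is about sets of vectors, so repeated members of a
  family are invisible to it; the lemma below relates the two notions.\<close>

definition dependent_family :: "('i \<Rightarrow> 'b::real_vector) \<Rightarrow> 'i set \<Rightarrow> bool"
  where "dependent_family f I \<longleftrightarrow>
    (\<exists>J c. finite J \<and> J \<subseteq> I \<and> (\<Sum>i\<in>J. c i *\<^sub>R f i) = 0 \<and> (\<exists>i\<in>J. c i \<noteq> 0))"

lemma dependent_family_iff:
  "dependent_family f I \<longleftrightarrow> \<not> inj_on f I \<or> dependent (f ` I)"
proof (intro iffI disjCI; (elim disjE)?)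
  assume "dependent_family f I" and "\<not> dependent (f ` I)"
  then obtain J c i where J: "finite J" "J \<subseteq> I" "(\<Sum>i\<in>J. c i *\<^sub>R f i) = 0" "i \<in> J" "c i \<noteq> 0"
    unfolding dependent_family_def by blast
  show "\<not> inj_on f I"
  proof
    assume "inj_on f I"
    then have inj: "inj_on f J" using J(2) inj_on_subset by blast
    have "(\<Sum>v\<in>f ` J. c (the_inv_into J f v) *\<^sub>R v) = (\<Sum>i\<in>J. c i *\<^sub>R f i)"
      using inj by (simp add: sum.reindex the_inv_into_f_f)
    moreover have "c (the_inv_into J f (f i)) \<noteq> 0"
      using inj J by (simp add: the_inv_into_f_f)
    ultimately have "dependent (f ` I)"
      unfolding dependent_explicit using J
      by (intro exI[of _ "f ` J"] exI[of _ "\<lambda>v. c (the_inv_into J f v)"]) auto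
    with \<open>\<not> dependent (f ` I)\<close> show False ..
  qed
next
  assume "\<not> inj_on f I"
  then obtain i j where ij: "i \<in> I" "j \<in> I" "f i = f j" "i \<noteq> j"
    by (auto simp: inj_on_def)
  then show "dependent_family f I"
    unfolding dependent_family_def
    by (intro exI[of _ "{i, j}"] exI[of _ "\<lambda>k. if k = i then 1 else - 1"]) auto
next
  assume "dependent (f ` I)"
  then obtain t u v where t: "finite t" "t \<subseteq> f ` I" "(\<Sum>v\<in>t. u v *\<^sub>R v) = 0" "v \<in> t" "u v \<noteq> 0"
    unfolding dependent_explicit by blast
  then obtain J where J: "J \<subseteq> I" "inj_on f J" "t = f ` J"
    by (meson subset_image_inj)
  then show "dependent_family f I"
    unfolding dependent_family_def using t
    by (intro exI[of _ J] exI[of _ "\<lambda>i. u (f i)"]) (auto simp: sum.reindex finite_image_iff)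
qed

definition hypergraph :: "'a set \<Rightarrow> 'a set set \<Rightarrow> bool"
  where "hypergraph V E \<longleftrightarrow> finite V \<and> V \<noteq> {} \<and> E \<subseteq> Pow V"

text \<open>Like the members of \<^const>\<open>fun_space\<close>, matrices are padded with zeros outside their
  index sets.\<close>

definition incidence_matrix :: "'a set \<Rightarrow> 'a set set \<Rightarrow> 'a \<Rightarrow> 'a set \<Rightarrow> real"
  where "incidence_matrix V E v e = (if v \<in> V \<and> e \<in> E \<and> v \<in> e then 1 else 0)"

definition incidence_transpose_mult :: "'a set \<Rightarrow> 'a set set \<Rightarrow> ('a \<Rightarrow> real) \<Rightarrow> 'a set \<Rightarrow> real"
  where "incidence_transpose_mult V E x e = (\<Sum>v\<in>V. incidence_matrix V E v e * x v)"

definition incidence_row :: "'a set \<Rightarrow> 'a set set \<Rightarrow> 'a \<Rightarrow> 'a set \<Rightarrow> real"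
  where "incidence_row V E v = (\<lambda>e. incidence_matrix V E v e)"

lemma incidence_row_in_fun_space: "incidence_row V E v \<in> fun_space E"
  by (simp add: incidence_row_def incidence_matrix_def fun_space_def)

lemma incidence_transpose_mult_in_fun_space: "incidence_transpose_mult V E x \<in> fun_space E"
  by (simp add: incidence_transpose_mult_def incidence_matrix_def fun_space_def)

definition linearly_dependent_vertices :: "'a set \<Rightarrow> 'a set set \<Rightarrow> 'a set \<Rightarrow> bool"
  where "linearly_dependent_vertices V E U \<longleftrightarrow> dependent_family (incidence_row V E) U"

end

theory Submission
  imports Defs
begin

text \<open>
  Transposing the incidence matrix turns a product into a combination of rows: the image of \<open>x\<close>
  is the sum of the rows \<open>s\<^sub>v\<close> weighted by the values \<open>x v\<close>. A vanishing image is thus the same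
  thing as a linear relation among the rows indexed by the support of \<open>x\<close>. The coefficients of a
  nontrivial relation among the rows of \<open>U\<close>, extended by zero to a function on all vertices, form a
  nonzero kernel vector; conversely, the values of a nonzero kernel vector supported in \<open>U\<close> are the
  coefficients of such a relation. Coefficients here belong to vertices rather than to row vectors,
  so vertices with equal rows need no separate treatment.
\<close>

lemma sum_fun_apply:
  fixes f :: "'i \<Rightarrow> 'a \<Rightarrow> 'b::comm_monoid_add"
  shows "(\<Sum>i\<in>I. f i) a = (\<Sum>i\<in>I. f i a)"
  by (induction I rule: infinite_finite_induct) simp_all

text \<open>Allowing any index set between the support of \<open>x\<close> and \<open>V\<close> lets the same identity serve for a
  relation given on an arbitrary finite set of vertices and for a kernel vector, whose relation is
  naturally indexed by its support.\<close>

lemma incidence_transpose_mult_eq_sum_rows: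
  assumes "finite V" and "J \<subseteq> V" and "supp x \<subseteq> J"
  shows "incidence_transpose_mult V E x = (\<Sum>v\<in>J. x v *\<^sub>R incidence_row V E v)"
proof
  fix e
  have "incidence_transpose_mult V E x e = (\<Sum>v\<in>J. incidence_matrix V E v e * x v)"
    unfolding incidence_transpose_mult_def
    using assms by (intro sum.mono_neutral_right) (auto simp: supp_def)
  then show "incidence_transpose_mult V E x e = (\<Sum>v\<in>J. x v *\<^sub>R incidence_row V E v) e"
    by (simp add: sum_fun_apply incidence_row_def mult.commute)
qed

theorem proposition2p2:
  fixes V :: "'a set" and E :: "'a set set" and U :: "'a set"
  assumes "hypergraph V E" and "U \<subseteq> V"
  shows "linearly_dependent_vertices V E U \<longleftrightarrow>
    (\<exists>x \<in> fun_space V. x \<noteq> 0 \<and> supp x \<subseteq> U \<and> incidence_transpose_mult V E x = 0)"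
proof
  have "finite V"
    using assms(1) by (simp add: hypergraph_def)
  {
    assume "linearly_dependent_vertices V E U"
    then obtain J c u where J: "J \<subseteq> U" and u: "u \<in> J" "c u \<noteq> 0"
      and relation: "(\<Sum>v\<in>J. c v *\<^sub>R incidence_row V E v) = 0"
      unfolding linearly_dependent_vertices_def dependent_family_def by blast
    define x where "x v = (if v \<in> J then c v else 0)" for v
    have supp: "supp x \<subseteq> J"
      by (auto simp: supp_def x_def)
    have "incidence_transpose_mult V E x = (\<Sum>v\<in>J. x v *\<^sub>R incidence_row V E v)"
      using \<open>finite V\<close> J \<open>U \<subseteq> V\<close> supp
      by (intro incidence_transpose_mult_eq_sum_rows) auto
    also have "\<dots> = 0"
      using relation by (simp add: x_def)
    finally have "incidence_transpose_mult V E x = 0" .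
    moreover have "x u \<noteq> 0"
      using u by (simp add: x_def)
    then have "x \<noteq> 0"
      by auto
    moreover have "x \<in> fun_space V"
      using J \<open>U \<subseteq> V\<close> by (auto simp: fun_space_def x_def)
    ultimately show "\<exists>x \<in> fun_space V. x \<noteq> 0 \<and> supp x \<subseteq> U \<and> incidence_transpose_mult V E x = 0"
      using supp J by blast
  next
    assume "\<exists>x \<in> fun_space V. x \<noteq> 0 \<and> supp x \<subseteq> U \<and> incidence_transpose_mult V E x = 0"
    then obtain x where x: "x \<noteq> 0" "supp x \<subseteq> U" "incidence_transpose_mult V E x = 0"
      by blast
    have "supp x \<subseteq> V"
      using x(2) \<open>U \<subseteq> V\<close> by blast
    then have "(\<Sum>v\<in>supp x. x v *\<^sub>R incidence_row V E v) = 0"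
      using incidence_transpose_mult_eq_sum_rows[OF \<open>finite V\<close> _ order_refl] x(3) by metis
    moreover have "finite (supp x)"
      using \<open>supp x \<subseteq> V\<close> \<open>finite V\<close> by (rule finite_subset)
    moreover have "\<exists>v\<in>supp x. x v \<noteq> 0"
      using x(1) by (auto simp: supp_def fun_eq_iff)
    ultimately show "linearly_dependent_vertices V E U"
      unfolding linearly_dependent_vertices_def dependent_family_def
      using x(2) by blast
  }
qed

end
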